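(* Let $(A,\cdot)$ be an anti-flexible algebra, let $(M,l,r)$ be a bimodule of $(A,\cdot)$, and let $(T,N,S)$ be an $\mathcal{ON}$-structure on the $A$-bimodule $M$. Then $T$ and $N\circ T$ are compatible Rota-Baxter operators on $(A,\cdot)$ with respect to $(M,l,r)$.
   Context: All vector spaces are finite-dimensional over the complex field $\mathbb{K}$; $gl(V)$ denotes the linear endomorphisms of $V$. An anti-flexible algebra is a vector space $A$ with a bilinear product $\cdot$ such that $(a\cdot b)\cdot c-a\cdot(b\cdot c)=(c\cdot b)\cdot a-c\cdot(b\cdot a)$ for all $a,b,c\in A$. A bimodule of $(A,\cdot)$ is a triple $(M,l,r)$ with $M$ a vector space and $l,r:A\to gl(M)$ linear maps such that for all $a,b\in A$: $l(a\cdot b)-l(a)l(b)=r(a)r(b)-r(b\cdot a)$ and $l(a)r(b)-r(b)l(a)=l(b)r(a)-r(a)l(b)$. A Rota-Baxter operator on $(A,\cdot)$ with respect to $(M,l,r)$ is a linear map $T:M\to A$ with $T(m)\cdot T(n)=T(l(T(m))n+r(T(n))m)$ for all $m,n\in M$. Two Rota-Baxter operators $T_1,T_2:M\to A$ (with respect to the same bimodule) are compatible if $T_1+T_2$ is also a Rota-Baxter operator. A Nijenhuis operator on $(A,\cdot)$ is a linear map $N:A\to A$ with $N(a)\cdot N(b)=N(N(a)\cdot b+a\cdot N(b)-N(a\cdot b))$ for all $a,b\in A$. A Nijenhuis structure on the $A$-bimodule $M$ is a pair $(N,S)$ with $N\in gl(A)$ a Nijenhuis operator on $(A,\cdot)$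 and $S\in gl(M)$ such that for all $a\in A$, $m\in M$: $l(N(a))S(m)=S(l(N(a))m)+l(a)S^2(m)-S(l(a)S(m))$ and $r(N(a))S(m)=S(r(N(a))m)+r(a)S^2(m)-S(r(a)S(m))$. For a linear map $T:M\to A$ put $m\star_T n=l(T(m))n+r(T(n))m$, and for $S\in gl(M)$ put $m\star_T^S n=S(m)\star_T n+m\star_T S(n)-S(m\star_T n)$. An $\mathcal{ON}$-structure on the $A$-bimodule $M$ is a triple $(T,N,S)$ where $T:M\to A$ is a Rota-Baxter operator, $(N,S)$ is a Nijenhuis structure on the $A$-bimodule $M$, $N\circ T=T\circ S$, and $m\star_{N\circ T}n=m\star_T^S n$ for all $m,n\in M$. *)

theory Defs
  imports Complex_Main
begin

text \<open>
  Vector spaces are abelian-group types equipped with an explicit scalar multiplication by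
  complex numbers, in the style of \<^theory>\<open>HOL.Vector_Spaces\<close>.
\<close>

definition fin_dim_space :: "(complex \<Rightarrow> 'a::ab_group_add \<Rightarrow> 'a) \<Rightarrow> bool" where
  "fin_dim_space s \<longleftrightarrow> (\<exists>B. finite_dimensional_vector_space s B)"

definition gl :: "(complex \<Rightarrow> 'a::ab_group_add \<Rightarrow> 'a) \<Rightarrow> ('a \<Rightarrow> 'a) set" where
  "gl s = {f. Vector_Spaces.linear s s f}"

definition anti_flexible_algebra ::
  "(complex \<Rightarrow> 'a::ab_group_add \<Rightarrow> 'a) \<Rightarrow> ('a \<Rightarrow> 'a \<Rightarrow> 'a) \<Rightarrow> bool" where
  "anti_flexible_algebra sA mul \<longleftrightarrow>
     fin_dim_space sA \<and>
     (\<forall>a. Vector_Spaces.linear sA sA (\<lambda>b. mul a b)) \<and>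
     (\<forall>b. Vector_Spaces.linear sA sA (\<lambda>a. mul a b)) \<and>
     (\<forall>a b c. mul (mul a b) c - mul a (mul b c) = mul (mul c b) a - mul c (mul b a))"

text \<open>
  A linear map from \<open>A\<close> to \<open>gl(M)\<close> takes values in \<^const>\<open>gl\<close> and is linear for the pointwise
  vector space structure on endomorphisms.
\<close>

definition linear_into_gl ::
  "(complex \<Rightarrow> 'a::ab_group_add \<Rightarrow> 'a) \<Rightarrow> (complex \<Rightarrow> 'm::ab_group_add \<Rightarrow> 'm) \<Rightarrow>
   ('a \<Rightarrow> 'm \<Rightarrow> 'm) \<Rightarrow> bool" where
  "linear_into_gl sA sM f \<longleftrightarrow>
     (\<forall>a. f a \<in> gl sM) \<and> (\<forall>m. Vector_Spaces.linear sA sM (\<lambda>a. f a m))"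

definition bimodule ::
  "(complex \<Rightarrow> 'a::ab_group_add \<Rightarrow> 'a) \<Rightarrow> ('a \<Rightarrow> 'a \<Rightarrow> 'a) \<Rightarrow>
   (complex \<Rightarrow> 'm::ab_group_add \<Rightarrow> 'm) \<Rightarrow> ('a \<Rightarrow> 'm \<Rightarrow> 'm) \<Rightarrow> ('a \<Rightarrow> 'm \<Rightarrow> 'm) \<Rightarrow> bool" where
  "bimodule sA mul sM l r \<longleftrightarrow>
     fin_dim_space sM \<and> linear_into_gl sA sM l \<and> linear_into_gl sA sM r \<and>
     (\<forall>a b m. l (mul a b) m - l a (l b m) = r a (r b m) - r (mul b a) m) \<and>
     (\<forall>a b m. l a (r b m) - r b (l a m) = l b (r a m) - r a (l b m))"

definition star ::
  "('a \<Rightarrow> 'm::ab_group_add \<Rightarrow> 'm) \<Rightarrow> ('a \<Rightarrow> 'm \<Rightarrow> 'm) \<Rightarrow> ('m \<Rightarrow> 'a) \<Rightarrow> 'm \<Rightarrow> 'm \<Rightarrow> 'm" where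
  "star l r T m n = l (T m) n + r (T n) m"

definition star_twist ::
  "('a \<Rightarrow> 'm::ab_group_add \<Rightarrow> 'm) \<Rightarrow> ('a \<Rightarrow> 'm \<Rightarrow> 'm) \<Rightarrow> ('m \<Rightarrow> 'a) \<Rightarrow> ('m \<Rightarrow> 'm) \<Rightarrow>
   'm \<Rightarrow> 'm \<Rightarrow> 'm" where
  "star_twist l r T S m n = star l r T (S m) n + star l r T m (S n) - S (star l r T m n)"

definition rota_baxter ::
  "(complex \<Rightarrow> 'a::ab_group_add \<Rightarrow> 'a) \<Rightarrow> ('a \<Rightarrow> 'a \<Rightarrow> 'a) \<Rightarrow>
   (complex \<Rightarrow> 'm::ab_group_add \<Rightarrow> 'm) \<Rightarrow> ('a \<Rightarrow> 'm \<Rightarrow> 'm) \<Rightarrow> ('a \<Rightarrow> 'm \<Rightarrow> 'm) \<Rightarrow>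
   ('m \<Rightarrow> 'a) \<Rightarrow> bool" where
  "rota_baxter sA mul sM l r T \<longleftrightarrow>
     Vector_Spaces.linear sM sA T \<and>
     (\<forall>m n. mul (T m) (T n) = T (l (T m) n + r (T n) m))"

definition compatible_rota_baxter ::
  "(complex \<Rightarrow> 'a::ab_group_add \<Rightarrow> 'a) \<Rightarrow> ('a \<Rightarrow> 'a \<Rightarrow> 'a) \<Rightarrow>
   (complex \<Rightarrow> 'm::ab_group_add \<Rightarrow> 'm) \<Rightarrow> ('a \<Rightarrow> 'm \<Rightarrow> 'm) \<Rightarrow> ('a \<Rightarrow> 'm \<Rightarrow> 'm) \<Rightarrow>
   ('m \<Rightarrow> 'a) \<Rightarrow> ('m \<Rightarrow> 'a) \<Rightarrow> bool" where
  "compatible_rota_baxter sA mul sM l r T1 T2 \<longleftrightarrow>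
     rota_baxter sA mul sM l r T1 \<and> rota_baxter sA mul sM l r T2 \<and>
     rota_baxter sA mul sM l r (\<lambda>m. T1 m + T2 m)"

definition nijenhuis_operator ::
  "(complex \<Rightarrow> 'a::ab_group_add \<Rightarrow> 'a) \<Rightarrow> ('a \<Rightarrow> 'a \<Rightarrow> 'a) \<Rightarrow> ('a \<Rightarrow> 'a) \<Rightarrow> bool" where
  "nijenhuis_operator sA mul N \<longleftrightarrow>
     N \<in> gl sA \<and>
     (\<forall>a b. mul (N a) (N b) = N (mul (N a) b + mul a (N b) - N (mul a b)))"

definition nijenhuis_structure ::
  "(complex \<Rightarrow> 'a::ab_group_add \<Rightarrow> 'a) \<Rightarrow> ('a \<Rightarrow> 'a \<Rightarrow> 'a) \<Rightarrow>
   (complex \<Rightarrow> 'm::ab_group_add \<Rightarrow> 'm) \<Rightarrow> ('a \<Rightarrow> 'm \<Rightarrow> 'm) \<Rightarrow> ('a \<Rightarrow> 'm \<Rightarrow> 'm) \<Rightarrow>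
   ('a \<Rightarrow> 'a) \<Rightarrow> ('m \<Rightarrow> 'm) \<Rightarrow> bool" where
  "nijenhuis_structure sA mul sM l r N S \<longleftrightarrow>
     nijenhuis_operator sA mul N \<and> S \<in> gl sM \<and>
     (\<forall>a m. l (N a) (S m) = S (l (N a) m) + l a (S (S m)) - S (l a (S m))) \<and>
     (\<forall>a m. r (N a) (S m) = S (r (N a) m) + r a (S (S m)) - S (r a (S m)))"

definition ON_structure ::
  "(complex \<Rightarrow> 'a::ab_group_add \<Rightarrow> 'a) \<Rightarrow> ('a \<Rightarrow> 'a \<Rightarrow> 'a) \<Rightarrow>
   (complex \<Rightarrow> 'm::ab_group_add \<Rightarrow> 'm) \<Rightarrow> ('a \<Rightarrow> 'm \<Rightarrow> 'm) \<Rightarrow> ('a \<Rightarrow> 'm \<Rightarrow> 'm) \<Rightarrow>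
   ('m \<Rightarrow> 'a) \<Rightarrow> ('a \<Rightarrow> 'a) \<Rightarrow> ('m \<Rightarrow> 'm) \<Rightarrow> bool" where
  "ON_structure sA mul sM l r T N S \<longleftrightarrow>
     rota_baxter sA mul sM l r T \<and> nijenhuis_structure sA mul sM l r N S \<and>
     N \<circ> T = T \<circ> S \<and>
     (\<forall>m n. star l r (N \<circ> T) m n = star_twist l r T S m n)"

end

theory Submission
  imports Defs
begin

text \<open>
  Since \<open>N \<circ> T = T \<circ> S\<close>, each product \<open>N (T m) \<cdot> T n = T (S m) \<cdot> T n\<close> is given by the Rota-Baxter
  identity of \<open>T\<close>, and likewise with the factors exchanged. Adding the two gives
  \<open>N (T m) \<cdot> T n + T m \<cdot> N (T n) = T (S m \<star>\<^sub>T n + m \<star>\<^sub>T S n)\<close>. The correction term in \<open>\<star>\<^sub>T\<^sup>S\<close> is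
  \<open>S (m \<star>\<^sub>T n)\<close>, and \<open>T\<close> maps it to \<open>N (T (m \<star>\<^sub>T n))\<close>. As \<open>\<star>\<close> for \<open>N \<circ> T\<close> is \<open>\<star>\<^sub>T\<^sup>S\<close>, it follows that
  \<open>N (T m) \<cdot> T n + T m \<cdot> N (T n) = T (m \<star>\<^bsub>NT\<^esub> n) + N (T (m \<star>\<^sub>T n))\<close>,
  which is \<open>ON_structure_mixed_identity\<close>. This one identity does two things. It is the bilinear
  cross term that makes the sum of two Rota-Baxter operators Rota-Baxter
  (\<open>rota_baxter_add\<close>). Substituted into the Nijenhuis identity of \<open>N\<close> on the elements
  \<open>T m\<close> and \<open>T n\<close>, it makes the two double applications of \<open>N\<close> cancel, and what is left is the
  Rota-Baxter identity of \<open>N \<circ> T\<close> (\<open>ON_structure_rota_baxter_comp\<close>).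
\<close>

lemma anti_flexible_algebra_add:
  assumes "anti_flexible_algebra sA mul"
  shows "mul (a + b) c = mul a c + mul b c" "mul a (b + c) = mul a b + mul a c"
  using assms unfolding anti_flexible_algebra_def Vector_Spaces.linear_iff by blast+

lemma bimodule_add:
  assumes "bimodule sA mul sM l r"
  shows "l (a + b) m = l a m + l b m" "r (a + b) m = r a m + r b m"
  using assms unfolding bimodule_def linear_into_gl_def Vector_Spaces.linear_iff by blast+

lemma linear_pointwise_add:
  assumes "Vector_Spaces.linear s1 s2 f" "Vector_Spaces.linear s1 s2 g"
  shows "Vector_Spaces.linear s1 s2 (\<lambda>x. f x + g x)"
proof -
  interpret vector_space_pair s1 s2
    using assms(1) unfolding Vector_Spaces.linear_iff vector_space_pair_def by blast
  show ?thesis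
    using assms by (rule linear_compose_add)
qed

text \<open>
  Expanding the Rota-Baxter identity of \<open>T1 + T2\<close> bilinearly leaves, after removing the identities
  of \<open>T1\<close> and \<open>T2\<close>, exactly the terms that involve both operators; the last hypothesis says that
  those agree.
\<close>

lemma rota_baxter_add:
  assumes alg: "anti_flexible_algebra sA mul" and bim: "bimodule sA mul sM l r"
    and T1: "rota_baxter sA mul sM l r T1" and T2: "rota_baxter sA mul sM l r T2"
    and mixed: "\<And>m n. mul (T2 m) (T1 n) + mul (T1 m) (T2 n)
                  = T1 (star l r T2 m n) + T2 (star l r T1 m n)"
  shows "rota_baxter sA mul sM l r (\<lambda>m. T1 m + T2 m)"
  unfolding rota_baxter_def
proof (intro conjI allI)
  show "Vector_Spaces.linear sM sA (\<lambda>m. T1 m + T2 m)"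
    using T1 T2 by (simp add: rota_baxter_def linear_pointwise_add)
next
  fix m n
  have add: "T1 (x + y) = T1 x + T1 y" "T2 (x + y) = T2 x + T2 y" for x y
    using T1 T2 by (simp_all add: rota_baxter_def Vector_Spaces.linear_iff)
  have rb: "mul (T1 m) (T1 n) = T1 (star l r T1 m n)" "mul (T2 m) (T2 n) = T2 (star l r T2 m n)"
    using T1 T2 by (simp_all add: rota_baxter_def star_def)
  have star_add: "l (T1 m + T2 m) n + r (T1 n + T2 n) m = star l r T1 m n + star l r T2 m n"
    by (simp add: star_def bimodule_add[OF bim] algebra_simps)
  have "mul (T1 m + T2 m) (T1 n + T2 n)
      = mul (T1 m) (T1 n) + (mul (T2 m) (T1 n) + mul (T1 m) (T2 n)) + mul (T2 m) (T2 n)"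
    by (simp add: anti_flexible_algebra_add[OF alg] algebra_simps)
  also have "\<dots> = T1 (star l r T1 m n + star l r T2 m n) + T2 (star l r T1 m n + star l r T2 m n)"
    using mixed[of m n] by (simp add: rb add algebra_simps)
  finally show "mul (T1 m + T2 m) (T1 n + T2 n)
      = T1 (l (T1 m + T2 m) n + r (T1 n + T2 n) m) + T2 (l (T1 m + T2 m) n + r (T1 n + T2 n) m)"
    by (simp only: star_add)
qed

text \<open>
  Both products on the left have factors in the image of \<open>T\<close>, because \<open>N \<circ> T = T \<circ> S\<close>; hence the
  Rota-Baxter identity of \<open>T\<close> evaluates them.
\<close>

lemma ON_structure_mixed_identity:
  assumes "ON_structure sA mul sM l r T N S"
  shows "mul (N (T m)) (T n) + mul (T m) (N (T n))
    = T (star l r (N \<circ> T) m n) + N (T (star l r T m n))"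
proof -
  have T: "rota_baxter sA mul sM l r T" and NT: "\<And>x. N (T x) = T (S x)"
    and twist: "star l r (N \<circ> T) m n = star_twist l r T S m n"
    using assms by (auto simp: ON_structure_def fun_eq_iff)
  interpret Vector_Spaces.linear sM sA T
    using T by (simp add: rota_baxter_def)
  have rb: "mul (T x) (T y) = T (star l r T x y)" for x y
    using T by (simp add: rota_baxter_def star_def)
  show ?thesis
    by (simp add: twist NT rb star_twist_def add diff)
qed

lemma ON_structure_rota_baxter_comp:
  assumes ON: "ON_structure sA mul sM l r T N S"
  shows "rota_baxter sA mul sM l r (N \<circ> T)"
  unfolding rota_baxter_def
proof (intro conjI allI)
  have T: "rota_baxter sA mul sM l r T" and N: "nijenhuis_operator sA mul N"
    using ON by (auto simp: ON_structure_def nijenhuis_structure_def)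
  show "Vector_Spaces.linear sM sA (N \<circ> T)"
    using T N by (auto simp: rota_baxter_def nijenhuis_operator_def gl_def
        intro: Vector_Spaces.linear_compose)
  fix m n
  have "mul (N (T m)) (N (T n))
      = N (mul (N (T m)) (T n) + mul (T m) (N (T n)) - N (mul (T m) (T n)))"
    using N by (simp add: nijenhuis_operator_def)
  also have "\<dots> = N (T (star l r (N \<circ> T) m n))"
    using T by (simp add: ON_structure_mixed_identity[OF ON] rota_baxter_def star_def)
  finally show "mul ((N \<circ> T) m) ((N \<circ> T) n)
      = (N \<circ> T) (l ((N \<circ> T) m) n + r ((N \<circ> T) n) m)"
    by (simp add: star_def)
qed

theorem proposition5p6:
  fixes sA :: "complex \<Rightarrow> 'a::ab_group_add \<Rightarrow> 'a"
    and mul :: "'a \<Rightarrow> 'a \<Rightarrow> 'a"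
    and sM :: "complex \<Rightarrow> 'm::ab_group_add \<Rightarrow> 'm"
    and l r :: "'a \<Rightarrow> 'm \<Rightarrow> 'm"
    and T :: "'m \<Rightarrow> 'a"
    and N :: "'a \<Rightarrow> 'a"
    and S :: "'m \<Rightarrow> 'm"
  assumes "anti_flexible_algebra sA mul"
    and "bimodule sA mul sM l r"
    and "ON_structure sA mul sM l r T N S"
  shows "compatible_rota_baxter sA mul sM l r T (N \<circ> T)"
proof -
  have T: "rota_baxter sA mul sM l r T"
    using assms(3) by (simp add: ON_structure_def)
  have NT: "rota_baxter sA mul sM l r (N \<circ> T)"
    using assms(3) by (rule ON_structure_rota_baxter_comp)
  have "rota_baxter sA mul sM l r (\<lambda>m. T m + (N \<circ> T) m)"
    using assms(1,2) T NT
    by (rule rota_baxter_add) (simp add: ON_structure_mixed_identity[OF assms(3)])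
  with T NT show ?thesis
    by (simp add: compatible_rota_baxter_def)
qed

end
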